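(* Let $n\in\mathbb{N}^+$, $a_1,\dots,a_n>0$, and let $m,p,t,r,\beta\in\mathbb{R}$ with $t\ge 0$ and $\beta p t\neq 0$. Put $s=\sum_{i=1}^n a_i^p$ and assume $ts>r a_i^p$ for each $i=1,\dots,n$. Let $X_1<X_2$ be as defined in the context. Then $$\sum_{i=1}^n\frac{a_i^m}{(ts-ra_i^p)^\beta}\ \ge\ \frac1{(nt-r)^\beta}\sum_{i=1}^n a_i^{m-\beta p}$$ holds in each of the following cases: (i) $\beta>0$ and one of the following holds: (i.1) $\beta\ge 1$, $r\ge 0$ and [$\beta p^2\le pm$ or $m=(\beta+1)p$], (i.2) $\beta\ge 1$, $r<0$ and $(\beta+1)p^2\le pm$, (i.3) $\beta\in(0,1)$, $r\ge 0$ and $p^2\le pm\le(\beta+1)p^2$, (i.4) $r<0$, $(\beta\vee 1)p^2\le pm<(\beta+1)p^2$ and $(t-r)X_1\ge 1$; (ii) $\beta\in(-1,0)$ and one of the following holds: (ii.1) $r=0$ and $\beta p^2<pm\le 0$, (ii.2) $t\ge r$ and $pm\le\beta p^2$, (ii.3) $t>r\ne 0$, $\beta p^2<pm\le 0$ and $(t-r)X_2\ge 1$; (iii) $\beta=-1$ and one of the following holds: (iii.1) $pm\le -p^2$, or $m=0$, (iii.2) $r\ge 0$ and $-p^2<pm<0$, (iii.3) $r<0$, $-p^2<pm<0$ and $\dfrac{(m-p)t}{(m+p)r}\ge 1$; (iv) $\beta<-1$ and one of the following holds: (iv.1) $pm\le\beta p^2$, or $m=(\beta+1)p$, (iv.2)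 $r\ge 0$ and $\beta p^2<pm<(\beta+1)p^2$, (iv.3) $r<0$, $\beta p^2<pm<(\beta+1)p^2$ and $(t-r)X_1\ge 1$.
   Context: Here $a\vee b$ denotes the larger of $a,b\in\mathbb{R}$. For $\beta(\beta+1)r\neq 0$ (and $p\ne 0$) let $$f(x)=x^2+\frac{2m}{(\beta+1)rp}x+\frac{m(m-p)}{\beta(\beta+1)r^2p^2},\qquad x\in\mathbb{R}.$$ When the equation $f(x)=0$ has two different real solutions, they are denoted $X_1<X_2$, i.e. $$X_1=-\frac{m}{(\beta+1)rp}-\sqrt{\frac{m(\beta p+p-m)}{\beta(\beta+1)^2r^2p^2}},\qquad X_2=-\frac{m}{(\beta+1)rp}+\sqrt{\frac{m(\beta p+p-m)}{\beta(\beta+1)^2r^2p^2}}.$$ The assumption $ts>ra_i^p$ for all $i$ implies $nt>r$, so the right-hand side makes sense. All powers are real powers of positive numbers. *)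

theory Defs
  imports Complex_Main
begin

definition quad_f :: "real \<Rightarrow> real \<Rightarrow> real \<Rightarrow> real \<Rightarrow> real \<Rightarrow> real" where
  "quad_f m p r \<beta> x =
     x^2 + 2 * m / ((\<beta> + 1) * r * p) * x + m * (m - p) / (\<beta> * (\<beta> + 1) * r^2 * p^2)"

(* The smaller and the larger root of quad_f. The closed forms have this meaning only when
   \<beta> (\<beta> + 1) r p \<noteq> 0 and the radicand is positive (see root_X1_X2_iff and roots_eq_X1_X2);
   for a zero radicand both expressions give the double root. *)
definition root_X1 :: "real \<Rightarrow> real \<Rightarrow> real \<Rightarrow> real \<Rightarrow> real" where
  "root_X1 m p r \<beta> =
     - (m / ((\<beta> + 1) * r * p)) - sqrt (m * (\<beta> * p + p - m) / (\<beta> * (\<beta> + 1)^2 * r^2 * p^2))"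

definition root_X2 :: "real \<Rightarrow> real \<Rightarrow> real \<Rightarrow> real \<Rightarrow> real" where
  "root_X2 m p r \<beta> =
     - (m / ((\<beta> + 1) * r * p)) + sqrt (m * (\<beta> * p + p - m) / (\<beta> * (\<beta> + 1)^2 * r^2 * p^2))"

lemma quad_f_complete_square:
  assumes "\<beta> * (\<beta> + 1) * r * p \<noteq> 0"
  shows "quad_f m p r \<beta> x =
    (x + m / ((\<beta> + 1) * r * p))^2 - m * (\<beta> * p + p - m) / (\<beta> * (\<beta> + 1)^2 * r^2 * p^2)"
proof -
  define c where "c = \<beta> + 1"
  have nz: "\<beta> \<noteq> 0" "c \<noteq> 0" "r \<noteq> 0" "p \<noteq> 0" using assms by (auto simp: c_def)
  have b: "\<beta> = c - 1" by (simp add: c_def)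
  have "x^2 + 2 * m / (c * r * p) * x + m * (m - p) / (\<beta> * c * r^2 * p^2) =
    (x + m / (c * r * p))^2 - m * (c * p - m) / (\<beta> * c^2 * r^2 * p^2)"
    using nz by (simp add: field_simps power2_eq_square) (simp add: b algebra_simps)
  then show ?thesis by (simp add: quad_f_def c_def algebra_simps)
qed

lemma root_X1_X2_iff:
  assumes nz: "\<beta> * (\<beta> + 1) * r * p \<noteq> 0"
    and pos: "m * (\<beta> * p + p - m) / (\<beta> * (\<beta> + 1)^2 * r^2 * p^2) > 0"
  shows "root_X1 m p r \<beta> < root_X2 m p r \<beta>"
    and "quad_f m p r \<beta> x = 0 \<longleftrightarrow> x = root_X1 m p r \<beta> \<or> x = root_X2 m p r \<beta>"
proof -
  define D where "D = m * (\<beta> * p + p - m) / (\<beta> * (\<beta> + 1)^2 * r^2 * p^2)"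
  define h where "h = m / ((\<beta> + 1) * r * p)"
  have D: "D > 0" using pos by (simp add: D_def)
  have X: "root_X1 m p r \<beta> = - h - sqrt D" "root_X2 m p r \<beta> = - h + sqrt D"
    by (simp_all add: root_X1_def root_X2_def D_def h_def)
  have "sqrt D > 0" using D by simp
  then show "root_X1 m p r \<beta> < root_X2 m p r \<beta>" unfolding X by linarith
  have "quad_f m p r \<beta> x = (x + h)^2 - (sqrt D)^2"
    using quad_f_complete_square[OF nz, of m x] D by (simp add: D_def h_def)
  then have "quad_f m p r \<beta> x = 0 \<longleftrightarrow> (x + h)^2 = (sqrt D)^2" by simp
  also have "\<dots> \<longleftrightarrow> x + h = sqrt D \<or> x + h = - sqrt D" by (rule power2_eq_iff)
  finally show "quad_f m p r \<beta> x = 0 \<longleftrightarrow> x = root_X1 m p r \<beta> \<or> x = root_X2 m p r \<beta>"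
    unfolding X by (auto simp: algebra_simps)
qed

lemma roots_eq_X1_X2:
  assumes nz: "\<beta> * (\<beta> + 1) * r * p \<noteq> 0"
    and "quad_f m p r \<beta> x = 0" "quad_f m p r \<beta> y = 0" "x < y"
  shows "x = root_X1 m p r \<beta>" and "y = root_X2 m p r \<beta>"
proof -
  define D where "D = m * (\<beta> * p + p - m) / (\<beta> * (\<beta> + 1)^2 * r^2 * p^2)"
  define h where "h = m / ((\<beta> + 1) * r * p)"
  have sq: "(x + h)^2 = D" "(y + h)^2 = D"
    using assms(2,3) by (simp_all add: quad_f_complete_square[OF nz] D_def h_def)
  have "D \<ge> 0" using sq(1) by (metis zero_le_power2)
  moreover have "D \<noteq> 0" using sq \<open>x < y\<close> by auto
  ultimately have pos: "m * (\<beta> * p + p - m) / (\<beta> * (\<beta> + 1)^2 * r^2 * p^2) > 0"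
    unfolding D_def by linarith
  show "x = root_X1 m p r \<beta>" "y = root_X2 m p r \<beta>"
    using root_X1_X2_iff[OF nz pos] assms(2-4) by (metis less_asym order_less_irrefl)+
qed

end

theory Submission
  imports Defs "HOL-Analysis.Convex"
begin

text \<open>With \<open>q = m / p\<close> and \<open>y i = a i powr p / s\<close>, so that the \<open>y i\<close> sum to 1, the claim becomes
  \<open>(n t - r) powr (-\<beta>) * (\<Sum>i. y i powr (q - \<beta>)) \<le> (\<Sum>i. y i powr q * (t - r * y i) powr (-\<beta>))\<close>.
  Three arguments cover all cases. If \<open>\<beta> > 0\<close> and \<open>q \<ge> \<beta> + 1\<close>, or \<open>\<beta> \<le> -1\<close> and \<open>q \<le> \<beta> + 1\<close>, use Jensen
  for the function \<open>(t u - r) powr (-\<beta>)\<close> of \<open>u = 1 / y\<close> with weights \<open>y i powr (q - \<beta>)\<close>, and compare the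
  weighted mean of \<open>1 / y i\<close> with \<open>n\<close> by Chebyshev. If \<open>q \<le> \<beta> < 0\<close> and \<open>r \<le> t\<close>, Chebyshev splits off the
  factor \<open>y i powr (q - \<beta>)\<close> and AM-GM bounds the rest. In the remaining cases \<open>0 \<le> q - \<beta> \<le> 1\<close> and the
  summand on the right is convex in \<open>y i\<close>, so both sides are compared with their value at \<open>y i = 1 / n\<close>;
  with \<open>z = y / (t - r y)\<close> the second derivative has the sign of \<open>\<beta> (\<beta> + 1) quad_f m p r \<beta> z\<close>, which is
  where the roots \<open>X1\<close> and \<open>X2\<close> enter.\<close>

section \<open>Chebyshev's sum inequality\<close>

text \<open>Expanding the nonnegative double sum of \<open>(f i - f j) * (g i - g j)\<close> over
  all pairs gives twice the difference of the two sides.\<close>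

lemma chebyshev_sum_ge:
  fixes f g :: "'a \<Rightarrow> real"
  assumes "\<And>i j. i \<in> I \<Longrightarrow> j \<in> I \<Longrightarrow> (f i - f j) * (g i - g j) \<ge> 0"
  shows "(\<Sum>i\<in>I. f i) * (\<Sum>i\<in>I. g i) \<le> card I * (\<Sum>i\<in>I. f i * g i)"
proof -
  have "0 \<le> (\<Sum>i\<in>I. \<Sum>j\<in>I. (f i - f j) * (g i - g j))"
    using assms by (intro sum_nonneg)
  also have "\<dots> = (\<Sum>i\<in>I. \<Sum>j\<in>I. f i * g i + f j * g j) - (\<Sum>i\<in>I. \<Sum>j\<in>I. f i * g j + f j * g i)"
    by (simp add: algebra_simps sum_subtractf sum.distrib)
  also have "\<dots> = 2 * (card I * (\<Sum>i\<in>I. f i * g i)) - 2 * ((\<Sum>i\<in>I. f i) * (\<Sum>i\<in>I. g i))"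
    by (simp add: sum.distrib sum_product sum_distrib_left mult.commute
        sum.swap[of "\<lambda>i j. f j * g i"])
  finally show ?thesis by simp
qed

lemma chebyshev_sum_le:
  fixes f g :: "'a \<Rightarrow> real"
  assumes "\<And>i j. i \<in> I \<Longrightarrow> j \<in> I \<Longrightarrow> (f i - f j) * (g i - g j) \<le> 0"
  shows "card I * (\<Sum>i\<in>I. f i * g i) \<le> (\<Sum>i\<in>I. f i) * (\<Sum>i\<in>I. g i)"
  using chebyshev_sum_ge[of I f "\<lambda>i. - g i"] assms
  by (simp add: sum_negf algebra_simps)

text \<open>Provides the ordering hypothesis of Chebyshev's inequality for the pair
  \<open>y i powr e\<close> and \<open>y i\<close>.\<close>

lemma powr_mono_exponent_sgn:
  fixes x y e :: real
  assumes "0 < x" "0 < y"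
  shows "e \<ge> 0 \<Longrightarrow> (x powr e - y powr e) * (x - y) \<ge> 0"
    and "e \<le> 0 \<Longrightarrow> (x powr e - y powr e) * (x - y) \<le> 0"
proof -
  have *: "x \<le> y \<or> y \<le> x" by linarith
  show "(x powr e - y powr e) * (x - y) \<ge> 0" if "e \<ge> 0"
    using * assms that by (auto simp: zero_le_mult_iff intro: powr_mono2)
  show "(x powr e - y powr e) * (x - y) \<le> 0" if "e \<le> 0"
    using * assms that by (auto simp: mult_le_0_iff intro: powr_mono2')
qed

section \<open>Convexity of powers and of the summand\<close>

lemma convex_on_powr:
  fixes e :: real
  assumes "e \<le> 0 \<or> e \<ge> 1"
  shows "convex_on {0<..} (\<lambda>x. x powr e)"
proof (intro f''_ge0_imp_convex)
  fix x :: real assume x: "x \<in> {0<..}"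
  show "((\<lambda>x. x powr e) has_real_derivative e * x powr (e - 1)) (at x)"
    using x by (auto intro!: derivative_eq_intros)
  show "((\<lambda>x. e * x powr (e - 1)) has_real_derivative e * ((e - 1) * x powr (e - 1 - 1))) (at x)"
    using x by (auto intro!: derivative_eq_intros)
  have "0 \<le> e * (e - 1)"
    using assms by (auto simp: zero_le_mult_iff)
  then show "0 \<le> e * ((e - 1) * x powr (e - 1 - 1))"
    by (simp flip: mult.assoc)
qed simp

lemma concave_on_powr:
  fixes e :: real
  assumes "0 \<le> e" "e \<le> 1"
  shows "concave_on {0<..} (\<lambda>x. x powr e)"
proof (intro f''_le0_imp_concave)
  fix x :: real assume x: "x \<in> {0<..}"
  show "((\<lambda>x. x powr e) has_real_derivative e * x powr (e - 1)) (at x)"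
    using x by (auto intro!: derivative_eq_intros)
  show "((\<lambda>x. e * x powr (e - 1)) has_real_derivative e * ((e - 1) * x powr (e - 1 - 1))) (at x)"
    using x by (auto intro!: derivative_eq_intros)
  have "e * (e - 1) \<le> 0"
    using assms by (simp add: mult_nonneg_nonpos)
  then show "e * ((e - 1) * x powr (e - 1 - 1)) \<le> 0"
    by (simp add: mult_nonpos_nonneg flip: mult.assoc)
qed simp

text \<open>The expression in \<open>K\<close> is the second derivative divided by the positive
  factor \<open>y powr (q - 2) * (t - r * y) powr (- \<beta> - 2)\<close>. The bound
  \<open>y \<le> 1\<close> in \<open>S\<close> holds on the simplex and later allows
  \<open>y / (t - r * y)\<close> to be bounded by its value at 1.\<close>

lemma convex_on_powr_div_linear_powr:
  fixes q \<beta> t r :: real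
  defines "S \<equiv> {y. 0 < y \<and> y \<le> 1 \<and> r * y < t}"
  assumes K: "\<And>y. y \<in> S \<Longrightarrow>
      0 \<le> q * (q - 1) * (t - r * y)\<^sup>2 + 2 * q * \<beta> * r * y * (t - r * y) + \<beta> * (\<beta> + 1) * r\<^sup>2 * y\<^sup>2"
  shows "convex_on S (\<lambda>y. y powr q * (t - r * y) powr (- \<beta>))"
proof (rule f''_ge0_imp_convex)
  have "S = {0<..} \<inter> {..1} \<inter> {y. inner r y < t}"
    by (auto simp: S_def)
  then show "convex S"
    by (simp only:) (intro convex_Int convex_halfspace_lt convex_real_interval)
  fix y assume y: "y \<in> S"
  define w where "w = t - r * y"
  have pos: "0 < y" "0 < w" using y by (auto simp: S_def w_def)
  show "((\<lambda>y. y powr q * (t - r * y) powr (- \<beta>)) has_real_derivative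
      q * y powr (q - 1) * (t - r * y) powr (- \<beta>) + \<beta> * r * (y powr q * (t - r * y) powr (- \<beta> - 1))) (at y)"
    using pos by (auto intro!: derivative_eq_intros simp: w_def)
  show "((\<lambda>y. q * y powr (q - 1) * (t - r * y) powr (- \<beta>) + \<beta> * r * (y powr q * (t - r * y) powr (- \<beta> - 1)))
     has_real_derivative q * (q - 1) * y powr (q - 1 - 1) * (t - r * y) powr (- \<beta>)
       + 2 * q * \<beta> * r * y powr (q - 1) * (t - r * y) powr (- \<beta> - 1)
       + \<beta> * (\<beta> + 1) * r\<^sup>2 * (y powr q * (t - r * y) powr (- \<beta> - 1 - 1))) (at y)"
    using pos by (auto intro!: derivative_eq_intros simp: w_def algebra_simps power2_eq_square)
  \<comment> \<open>All powers are rewritten over the lowest exponents \<open>q - 1 - 1\<close> and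
    \<open>- \<beta> - 1 - 1\<close>, so that a common positive factor can be pulled out.\<close>
  have shift: "x powr (e - 1) = x powr (e - 1 - 1) * x" "x powr e = x powr (e - 1 - 1) * x\<^sup>2"
    if "x > 0" for x e :: real
    using that by (simp_all only: powr_diff) (simp_all add: power2_eq_square)
  note p = shift[OF pos(1), of q] shift[OF pos(2), of "- \<beta>"]
  have "q * (q - 1) * y powr (q - 1 - 1) * w powr (- \<beta>)
       + 2 * q * \<beta> * r * y powr (q - 1) * w powr (- \<beta> - 1)
       + \<beta> * (\<beta> + 1) * r\<^sup>2 * (y powr q * w powr (- \<beta> - 1 - 1))
     = y powr (q - 1 - 1) * w powr (- \<beta> - 1 - 1) *
       (q * (q - 1) * w\<^sup>2 + 2 * q * \<beta> * r * y * w + \<beta> * (\<beta> + 1) * r\<^sup>2 * y\<^sup>2)"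
    unfolding p by (simp only: algebra_simps)
  also have "\<dots> \<ge> 0"
    using K[OF y] pos by (simp add: w_def)
  finally show "0 \<le> q * (q - 1) * y powr (q - 1 - 1) * (t - r * y) powr (- \<beta>)
       + 2 * q * \<beta> * r * y powr (q - 1) * (t - r * y) powr (- \<beta> - 1)
       + \<beta> * (\<beta> + 1) * r\<^sup>2 * (y powr q * (t - r * y) powr (- \<beta> - 1 - 1))"
    by (simp add: w_def)
qed

section \<open>The estimates for a point of the simplex\<close>

text \<open>The inequality is homogeneous in the \<open>a i powr p\<close>, so dividing by their sum
  \<open>s\<close> leads to positive \<open>y i\<close> with sum 1; \<open>dom\<close> is the
  assumed bound divided by \<open>s\<close>.\<close>

locale simplex_point =
  fixes I :: "'a set" and y :: "'a \<Rightarrow> real" and t r :: real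
  assumes fin: "finite I" and ne: "I \<noteq> {}"
    and y_pos: "\<And>i. i \<in> I \<Longrightarrow> y i > 0"
    and y_sum: "(\<Sum>i\<in>I. y i) = 1"
    and t_pos: "t > 0"
    and dom: "\<And>i. i \<in> I \<Longrightarrow> r * y i < t"
begin

lemma card_pos: "real (card I) > 0"
  using fin ne by (simp add: card_gt_0_iff)

lemma y_le_1: "i \<in> I \<Longrightarrow> y i \<le> 1"
  using member_le_sum[of i I y] y_sum y_pos fin by (auto intro: less_imp_le)

lemma y_nz: "i \<in> I \<Longrightarrow> y i \<noteq> 0"
  using y_pos by fastforce

lemma nt_r_pos: "real (card I) * t - r > 0"
proof -
  have "r * (\<Sum>i\<in>I. y i) < (\<Sum>i\<in>I. t)"
    unfolding sum_distrib_left using fin ne dom by (intro sum_strict_mono)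
  then show ?thesis by (simp add: y_sum)
qed

text \<open>Chebyshev for \<open>y i powr e\<close> and \<open>y i\<close>, which are ordered alike
  for \<open>e \<ge> 0\<close> and oppositely for \<open>e \<le> 0\<close>; the sum of the
  \<open>y i\<close> is 1.\<close>

lemma sum_powr_shift:
  shows "e \<ge> 0 \<Longrightarrow> (\<Sum>i\<in>I. y i powr e) \<le> card I * (\<Sum>i\<in>I. y i powr (e + 1))"
    and "e \<le> 0 \<Longrightarrow> card I * (\<Sum>i\<in>I. y i powr (e + 1)) \<le> (\<Sum>i\<in>I. y i powr e)"
proof -
  have *: "(\<Sum>i\<in>I. y i powr e * y i) = (\<Sum>i\<in>I. y i powr (e + 1))"
    using y_pos by (intro sum.cong) (auto simp: powr_add abs_of_pos)
  show "(\<Sum>i\<in>I. y i powr e) \<le> card I * (\<Sum>i\<in>I. y i powr (e + 1))" if "e \<ge> 0"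
    using chebyshev_sum_ge[of I "\<lambda>i. y i powr e" y] powr_mono_exponent_sgn(1) y_pos that
    by (simp add: y_sum *)
  show "card I * (\<Sum>i\<in>I. y i powr (e + 1)) \<le> (\<Sum>i\<in>I. y i powr e)" if "e \<le> 0"
    using chebyshev_sum_le[of I "\<lambda>i. y i powr e" y] powr_mono_exponent_sgn(2) y_pos that
    by (simp add: y_sum *)
qed

text \<open>Jensen for the concave power with equal weights, the mean of the \<open>y i\<close>
  being \<open>1 / card I\<close>.\<close>

lemma sum_powr_le:
  assumes "0 \<le> e" "e \<le> 1"
  shows "(\<Sum>i\<in>I. y i powr e) \<le> card I * (1 / card I) powr e"
proof -
  have "(\<Sum>i\<in>I. (1 / card I) * y i powr e) \<le> (\<Sum>i\<in>I. (1 / card I) *\<^sub>R y i) powr e"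
    using fin ne y_pos card_pos
    by (intro concave_on_sum[where C="{0<..}"] concave_on_powr assms) auto
  also have "(\<Sum>i\<in>I. (1 / card I) *\<^sub>R y i) = 1 / card I"
    by (simp add: y_sum flip: sum_divide_distrib)
  finally show ?thesis
    using card_pos by (simp add: field_simps flip: sum_divide_distrib)
qed

text \<open>Each summand equals \<open>y i powr (q - \<beta>) * v i powr (- \<beta>)\<close> with
  \<open>v i = t / y i - r\<close>. The exponent \<open>- \<beta>\<close> is negative or at least 1,
  so Jensen applies once \<open>W\<close> normalises the weights.\<close>

lemma sum_ge_if_convex_in_inverse:
  assumes "\<beta> > 0 \<and> q \<ge> \<beta> + 1 \<or> \<beta> \<le> -1 \<and> q \<le> \<beta> + 1"
  shows "(\<Sum>i\<in>I. y i powr q * (t - r * y i) powr (- \<beta>))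
     \<ge> (real (card I) * t - r) powr (- \<beta>) * (\<Sum>i\<in>I. y i powr (q - \<beta>))"
proof -
  define W where "W = (\<Sum>i\<in>I. y i powr (q - \<beta>))"
  define V where "V = (\<Sum>i\<in>I. y i powr (q - \<beta> - 1))"
  define v where "v i = t / y i - r" for i
  have W: "W > 0" unfolding W_def using fin ne y_pos by (intro sum_pos) fastforce+
  have v: "v i > 0" if "i \<in> I" for i
    using dom[OF that] y_pos[OF that] by (simp add: v_def field_simps)
  have mean: "(\<Sum>i\<in>I. (y i powr (q - \<beta>) / W) *\<^sub>R v i) = t * (V / W) - r"
  proof -
    have "(\<Sum>i\<in>I. (y i powr (q - \<beta>) / W) *\<^sub>R v i)
        = (\<Sum>i\<in>I. t * y i powr (q - \<beta> - 1) / W - r * y i powr (q - \<beta>) / W)"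
      using y_nz y_pos W by (intro sum.cong refl) (auto simp: abs_of_pos v_def powr_diff diff_divide_distrib right_diff_distrib mult_ac)
    also have "\<dots> = t * V / W - r * W / W"
      unfolding V_def W_def by (simp add: sum_subtractf flip: sum_divide_distrib sum_distrib_left)
    finally show ?thesis using W by simp
  qed
  have mean_pos: "t * (V / W) - r > 0"
    unfolding mean[symmetric] using fin ne v W y_nz by (intro sum_pos) auto
  have "(t * (V / W) - r) powr (- \<beta>) \<le> (\<Sum>i\<in>I. (y i powr (q - \<beta>) / W) * v i powr (- \<beta>))"
    unfolding mean[symmetric]
  proof (rule convex_on_sum[where C="{0<..}"])
    show "convex_on {0<..} (\<lambda>x. x powr (- \<beta>))"
      using assms by (intro convex_on_powr) auto
    show "(\<Sum>i\<in>I. y i powr (q - \<beta>) / W) = 1"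
      using W by (simp add: W_def flip: sum_divide_distrib)
  qed (use fin ne v W in auto)
  also have "\<dots> = (\<Sum>i\<in>I. y i powr q * (t - r * y i) powr (- \<beta>)) / W"
    unfolding sum_divide_distrib
  proof (rule sum.cong[OF refl])
    fix i assume i: "i \<in> I"
    have v_eq: "v i = (t - r * y i) / y i"
      using y_pos[OF i] by (simp add: v_def field_simps)
    show "y i powr (q - \<beta>) / W * v i powr (- \<beta>) = y i powr q * (t - r * y i) powr (- \<beta>) / W"
      using y_pos[OF i] dom[OF i]
      unfolding v_eq by (simp add: powr_divide powr_diff powr_minus field_simps)
  qed
  finally have J: "W * (t * (V / W) - r) powr (- \<beta>) \<le> (\<Sum>i\<in>I. y i powr q * (t - r * y i) powr (- \<beta>))"
    using W by (simp add: field_simps)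
  \<comment> \<open>For positive \<open>\<beta>\<close> the power decreases and Chebyshev gives
    \<open>V / W \<le> card I\<close>; for \<open>\<beta> \<le> -1\<close> it increases and
    \<open>V / W \<ge> card I\<close>. Both reversals occur together.\<close>
  have "(real (card I) * t - r) powr (- \<beta>) \<le> (t * (V / W) - r) powr (- \<beta>)"
    using assms
  proof
    assume *: "\<beta> > 0 \<and> q \<ge> \<beta> + 1"
    then have "V / W \<le> card I"
      using sum_powr_shift(1)[of "q - \<beta> - 1"] W by (simp add: V_def W_def field_simps)
    then have "t * (V / W) \<le> t * card I" using t_pos by (intro mult_left_mono) auto
    then show ?thesis using * mean_pos by (intro powr_mono2') (auto simp: mult.commute)
  next
    assume *: "\<beta> \<le> -1 \<and> q \<le> \<beta> + 1"
    then have "V / W \<ge> card I"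
      using sum_powr_shift(2)[of "q - \<beta> - 1"] W by (simp add: V_def W_def field_simps)
    then have "t * (V / W) \<ge> t * card I" using t_pos by (intro mult_left_mono) auto
    then show ?thesis using * nt_r_pos by (intro powr_mono2) (auto simp: mult.commute)
  qed
  then have "W * (real (card I) * t - r) powr (- \<beta>) \<le> W * (t * (V / W) - r) powr (- \<beta>)"
    using W by (simp add: mult_left_mono)
  with J show ?thesis by (simp add: W_def mult.commute)
qed

text \<open>Since the \<open>y j\<close> sum to 1, \<open>t - r * y i\<close> is a nonnegative combination of the \<open>y j\<close>; the
  normalised coefficient matrix \<open>w\<close> is doubly stochastic, so summing the concavity of \<open>ln\<close> over the rows
  reproduces \<open>\<Sum>j. ln (y j)\<close>.\<close>

lemma sum_ln_quotient_ge:
  assumes "r \<le> t"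
  shows "card I * ln (real (card I) * t - r) \<le> (\<Sum>i\<in>I. ln ((t - r * y i) / y i))"
proof -
  define N where "N = real (card I) * t - r"
  \<comment> \<open>These are the coefficients in
    \<open>t - r * y i = (\<Sum>j\<in>I. t * y j) - r * y i\<close>, divided by their total
    \<open>N\<close>; \<open>r \<le> t\<close> makes the diagonal entry nonnegative.\<close>
  define w where "w i j = (if i = j then t - r else t) / N" for i j :: 'a
  have N: "N > 0" using nt_r_pos by (simp add: N_def)
  have w0: "w i j \<ge> 0" for i j using N assms t_pos by (simp add: w_def)
  have row: "(\<Sum>j\<in>I. w i j * g j) = (t * (\<Sum>j\<in>I. g j) - r * g i) / N" if "i \<in> I" for i and g :: "'a \<Rightarrow> real"
  proof -
    have "(\<Sum>j\<in>I. w i j * g j) = (\<Sum>j\<in>I. t * g j / N - (if j = i then r * g i / N else 0))"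
      by (intro sum.cong) (auto simp: w_def left_diff_distrib diff_divide_distrib)
    also have "\<dots> = t * (\<Sum>j\<in>I. g j) / N - r * g i / N"
      using fin that by (simp add: sum_subtractf flip: sum_divide_distrib sum_distrib_left)
    finally show ?thesis by (simp add: diff_divide_distrib)
  qed
  have row1: "(\<Sum>j\<in>I. w i j) = 1" if "i \<in> I" for i
    using row[OF that, of "\<lambda>_. 1"] N by (simp add: N_def mult.commute)
  have le: "(\<Sum>j\<in>I. w i j * ln (y j)) + ln N \<le> ln (t - r * y i)" if i: "i \<in> I" for i
  proof -
    have "(\<Sum>j\<in>I. w i j * ln (y j)) \<le> ln (\<Sum>j\<in>I. w i j *\<^sub>R y j)"
      using fin ne row1[OF i] w0 y_pos by (intro concave_on_sum[OF _ _ ln_concave]) auto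
    also have "(\<Sum>j\<in>I. w i j *\<^sub>R y j) = (t - r * y i) / N"
      using row[OF i, of y] by (simp add: y_sum)
    also have "ln \<dots> = ln (t - r * y i) - ln N"
      using N dom[OF i] by (simp add: ln_div)
    finally show ?thesis by simp
  qed
  \<comment> \<open>Summed over the rows, each \<open>ln (y j)\<close> receives the weight
    \<open>(card I * t - r) / N = 1\<close>.\<close>
  have "(\<Sum>i\<in>I. \<Sum>j\<in>I. w i j * ln (y j)) = (\<Sum>i\<in>I. (t * (\<Sum>j\<in>I. ln (y j)) - r * ln (y i)) / N)"
    by (intro sum.cong refl row)
  also have "\<dots> = (card I * (t * (\<Sum>j\<in>I. ln (y j))) - r * (\<Sum>j\<in>I. ln (y j))) / N"
    by (simp add: sum_subtractf flip: sum_divide_distrib sum_distrib_left)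
  also have "\<dots> = (\<Sum>j\<in>I. ln (y j))"
    using N by (simp add: N_def divide_simps) (simp add: algebra_simps)
  finally have cols: "(\<Sum>i\<in>I. \<Sum>j\<in>I. w i j * ln (y j)) = (\<Sum>j\<in>I. ln (y j))" .
  have "(\<Sum>i\<in>I. (\<Sum>j\<in>I. w i j * ln (y j)) + ln N) \<le> (\<Sum>i\<in>I. ln (t - r * y i))"
    by (intro sum_mono le)
  then have "(\<Sum>j\<in>I. ln (y j)) + card I * ln N \<le> (\<Sum>i\<in>I. ln (t - r * y i))"
    by (simp add: sum.distrib cols)
  moreover have "(\<Sum>i\<in>I. ln ((t - r * y i) / y i)) = (\<Sum>i\<in>I. ln (t - r * y i) - ln (y i))"
    using dom y_pos y_nz by (intro sum.cong) (auto simp: ln_div)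
  ultimately show ?thesis by (simp add: sum_subtractf N_def)
qed

text \<open>AM-GM: each power is \<open>exp (g * L i)\<close>, convexity of \<open>exp\<close> with
  equal weights bounds the mean from below, and the logarithmic estimate bounds the mean of the
  \<open>L i\<close>.\<close>

lemma sum_quotient_powr_ge:
  assumes "r \<le> t" "g \<ge> 0"
  shows "card I * (real (card I) * t - r) powr g \<le> (\<Sum>i\<in>I. ((t - r * y i) / y i) powr g)"
proof -
  define L where "L i = ln ((t - r * y i) / y i)" for i
  have "(real (card I) * t - r) powr g = exp (g * ln (real (card I) * t - r))"
    using nt_r_pos by (simp add: powr_def)
  also have "\<dots> \<le> exp (\<Sum>i\<in>I. (1 / card I) *\<^sub>R (g * L i))"
  proof -
    have "ln (real (card I) * t - r) \<le> (\<Sum>i\<in>I. L i) / card I"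
      using sum_ln_quotient_ge[OF assms(1)] card_pos by (simp add: L_def field_simps)
    then have "g * ln (real (card I) * t - r) \<le> g * ((\<Sum>i\<in>I. L i) / card I)"
      using assms(2) by (rule mult_left_mono)
    then show ?thesis by (simp flip: sum_divide_distrib sum_distrib_left)
  qed
  also have "\<dots> \<le> (\<Sum>i\<in>I. (1 / card I) * exp (g * L i))"
    using fin ne card_pos by (intro convex_on_sum[OF _ _ exp_convex]) auto
  also have "\<dots> = (\<Sum>i\<in>I. ((t - r * y i) / y i) powr g) / card I"
    unfolding sum_divide_distrib using dom y_nz
    by (intro sum.cong) (auto simp: powr_def L_def)
  finally show ?thesis using card_pos by (simp add: field_simps)
qed

text \<open>Both \<open>y powr (q - \<beta>)\<close> and \<open>(t / y - r) powr (- \<beta>)\<close>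
  are nonincreasing in \<open>y\<close>, and their product is the summand, so Chebyshev separates
  them.\<close>

lemma sum_ge_if_similarly_ordered:
  assumes "\<beta> < 0" "q \<le> \<beta>" "r \<le> t"
  shows "(\<Sum>i\<in>I. y i powr q * (t - r * y i) powr (- \<beta>))
     \<ge> (real (card I) * t - r) powr (- \<beta>) * (\<Sum>i\<in>I. y i powr (q - \<beta>))"
proof -
  let ?v = "\<lambda>i. (t - r * y i) / y i"
  have v: "?v i > 0" if "i \<in> I" for i
    using dom[OF that] y_pos[OF that] by simp
  have anti: "y j powr (q - \<beta>) \<le> y i powr (q - \<beta>) \<and> ?v j powr (- \<beta>) \<le> ?v i powr (- \<beta>)"
    if ij: "i \<in> I" "j \<in> I" "y i \<le> y j" for i j
  proof
    show "y j powr (q - \<beta>) \<le> y i powr (q - \<beta>)"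
      using assms ij y_pos by (intro powr_mono2') auto
    have "t * y i \<le> t * y j" using t_pos ij by simp
    then have "?v j \<le> ?v i"
      using y_pos[OF ij(1)] y_pos[OF ij(2)] by (simp add: field_simps)
    then show "?v j powr (- \<beta>) \<le> ?v i powr (- \<beta>)"
      using assms(1) v[OF ij(2)] by (intro powr_mono2) auto
  qed
  have "(\<Sum>i\<in>I. y i powr (q - \<beta>)) * (card I * (real (card I) * t - r) powr (- \<beta>))
      \<le> (\<Sum>i\<in>I. y i powr (q - \<beta>)) * (\<Sum>i\<in>I. ?v i powr (- \<beta>))"
    using assms by (intro mult_left_mono sum_quotient_powr_ge sum_nonneg) auto
  also have "\<dots> \<le> card I * (\<Sum>i\<in>I. y i powr (q - \<beta>) * ?v i powr (- \<beta>))"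
  proof (rule chebyshev_sum_ge)
    fix i j assume "i \<in> I" "j \<in> I"
    then show "0 \<le> (y i powr (q - \<beta>) - y j powr (q - \<beta>)) * (?v i powr (- \<beta>) - ?v j powr (- \<beta>))"
      using anti[of i j] anti[of j i] by (cases "y i \<le> y j") (auto simp: zero_le_mult_iff)
  qed
  also have "(\<Sum>i\<in>I. y i powr (q - \<beta>) * ?v i powr (- \<beta>))
      = (\<Sum>i\<in>I. y i powr q * (t - r * y i) powr (- \<beta>))"
    using dom y_pos
    by (intro sum.cong) (auto simp: powr_divide powr_diff powr_minus field_simps less_imp_neq[symmetric])
  finally have "card I * ((real (card I) * t - r) powr (- \<beta>) * (\<Sum>i\<in>I. y i powr (q - \<beta>)))
      \<le> card I * (\<Sum>i\<in>I. y i powr q * (t - r * y i) powr (- \<beta>))"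
    by (simp add: mult_ac)
  then show ?thesis using card_pos by simp
qed

text \<open>At the uniform point the two sides coincide. Concavity of
  \<open>y powr (q - \<beta>)\<close> makes the smaller side largest there, and convexity of the
  summand makes the larger side smallest there.\<close>

lemma sum_ge_if_convex:
  assumes K: "\<And>y. 0 < y \<Longrightarrow> y \<le> 1 \<Longrightarrow> r * y < t \<Longrightarrow>
      0 \<le> q * (q - 1) * (t - r * y)\<^sup>2 + 2 * q * \<beta> * r * y * (t - r * y) + \<beta> * (\<beta> + 1) * r\<^sup>2 * y\<^sup>2"
    and "\<beta> \<le> q" "q \<le> \<beta> + 1"
  shows "(\<Sum>i\<in>I. y i powr q * (t - r * y i) powr (- \<beta>))
     \<ge> (real (card I) * t - r) powr (- \<beta>) * (\<Sum>i\<in>I. y i powr (q - \<beta>))"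
proof -
  define c where "c = real (card I)"
  have c: "c > 0" "c * t - r > 0" using card_pos nt_r_pos by (simp_all add: c_def)
  have mean: "(\<Sum>i\<in>I. (1 / c) *\<^sub>R y i) = 1 / c"
    by (simp add: y_sum flip: sum_divide_distrib)
  have "(c * t - r) powr (- \<beta>) * (\<Sum>i\<in>I. y i powr (q - \<beta>))
      \<le> (c * t - r) powr (- \<beta>) * (c * (1 / c) powr (q - \<beta>))"
    using sum_powr_le[of "q - \<beta>"] assms(2,3) by (intro mult_left_mono) (auto simp: c_def)
  also have "\<dots> = c * ((1 / c) powr q * (t - r * (1 / c)) powr (- \<beta>))"
  proof -
    have "t - r * (1 / c) = (c * t - r) / c" using c by (simp add: field_simps)
    then show ?thesis using c by (simp add: powr_divide powr_diff powr_minus field_simps)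
  qed
  also have "\<dots> \<le> c * (\<Sum>i\<in>I. (1 / c) * (y i powr q * (t - r * y i) powr (- \<beta>)))"
  proof (intro mult_left_mono)
    have "(\<lambda>y. y powr q * (t - r * y) powr (- \<beta>)) (\<Sum>i\<in>I. (1 / c) *\<^sub>R y i)
       \<le> (\<Sum>i\<in>I. (1 / c) * (\<lambda>y. y powr q * (t - r * y) powr (- \<beta>)) (y i))"
      using fin ne y_pos y_le_1 dom c
      by (intro convex_on_sum[OF _ _ convex_on_powr_div_linear_powr] K) (auto simp: c_def)
    then show "(1 / c) powr q * (t - r * (1 / c)) powr (- \<beta>)
       \<le> (\<Sum>i\<in>I. (1 / c) * (y i powr q * (t - r * y i) powr (- \<beta>)))"
      unfolding mean .
  qed (use c in simp)
  also have "\<dots> = (\<Sum>i\<in>I. y i powr q * (t - r * y i) powr (- \<beta>))"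
    using c by (simp flip: sum_divide_distrib)
  finally show ?thesis by (simp add: c_def)
qed

end

section \<open>Sign of the quadratic and the convexity condition\<close>

lemma quad_f_nonneg_if_le_root_X1:
  assumes nz: "\<beta> * (\<beta> + 1) * r * p \<noteq> 0" and z: "z \<le> root_X1 m p r \<beta>"
  shows "quad_f m p r \<beta> z \<ge> 0"
proof -
  define D where "D = m * (\<beta> * p + p - m) / (\<beta> * (\<beta> + 1)^2 * r^2 * p^2)"
  define h where "h = m / ((\<beta> + 1) * r * p)"
  have "D \<le> (z + h)\<^sup>2"
  \<comment> \<open>A negative \<open>D\<close> lies below every square, whatever value
    \<open>sqrt D\<close> has.\<close>
  proof (cases "D \<ge> 0")
    case True
    have "sqrt D \<le> - (z + h)"
      using z by (simp add: root_X1_def D_def h_def)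
    then have "(sqrt D)\<^sup>2 \<le> (- (z + h))\<^sup>2"
      using True by (intro power_mono) auto
    then show ?thesis using True by (simp only: power2_minus real_sqrt_pow2)
  next
    case False
    then show ?thesis by (smt (verit) zero_le_power2)
  qed
  then show ?thesis
    by (simp add: quad_f_complete_square[OF nz] D_def h_def)
qed

text \<open>The value at 0 gives \<open>h\<^sup>2 \<le> D\<close>, so 0 lies between the roots, and
  so does everything from 0 up to the larger root.\<close>

lemma quad_f_nonpos_if_le_root_X2:
  assumes nz: "\<beta> * (\<beta> + 1) * r * p \<noteq> 0"
    and z: "0 \<le> z" "z \<le> root_X2 m p r \<beta>" and 0: "quad_f m p r \<beta> 0 \<le> 0"
  shows "quad_f m p r \<beta> z \<le> 0"
proof -
  define D where "D = m * (\<beta> * p + p - m) / (\<beta> * (\<beta> + 1)^2 * r^2 * p^2)"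
  define h where "h = m / ((\<beta> + 1) * r * p)"
  have hD: "h\<^sup>2 \<le> D"
    using 0 by (simp add: quad_f_complete_square[OF nz] D_def h_def)
  then have "\<bar>h\<bar> \<le> sqrt D"
    by (simp add: real_le_rsqrt)
  moreover have "z + h \<le> sqrt D"
    using z by (simp add: root_X2_def D_def h_def)
  ultimately have "\<bar>z + h\<bar> \<le> sqrt D"
    using z(1) by linarith
  then have "(z + h)\<^sup>2 \<le> D"
    using hD by (metis abs_le_square_iff abs_of_nonneg order_trans real_sqrt_ge_zero real_sqrt_pow2 zero_le_power2)
  then show ?thesis
    by (simp add: quad_f_complete_square[OF nz] D_def h_def)
qed

text \<open>The left side is a quadratic form in \<open>y\<close> and \<open>w\<close>, hence
  \<open>w\<^sup>2\<close> times a quadratic in \<open>y / w\<close>. Convexity thus asks for the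
  sign of \<open>\<beta> * (\<beta> + 1)\<close> on \<open>quad_f\<close>.\<close>

lemma second_derivative_factor_eq_quad_f:
  assumes nz: "\<beta> * (\<beta> + 1) * r * p \<noteq> 0" and w: "w \<noteq> 0" and q: "q = m / p"
  shows "q * (q - 1) * w\<^sup>2 + 2 * q * \<beta> * r * y * w + \<beta> * (\<beta> + 1) * r\<^sup>2 * y\<^sup>2
    = \<beta> * (\<beta> + 1) * (r * w)\<^sup>2 * quad_f m p r \<beta> (y / w)"
proof -
  have nz': "\<beta> \<noteq> 0" "\<beta> + 1 \<noteq> 0" "r \<noteq> 0" "p \<noteq> 0" using nz by auto
  have m: "m = q * p" using q nz' by simp
  have "2 * m / ((\<beta> + 1) * r * p) = 2 * q / ((\<beta> + 1) * r)"
    "m * (m - p) / (\<beta> * (\<beta> + 1) * r\<^sup>2 * p\<^sup>2) = q * (q - 1) / (\<beta> * (\<beta> + 1) * r\<^sup>2)"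
    using nz' by (simp_all add: m power2_eq_square divide_simps) (simp_all add: algebra_simps)
  then have "quad_f m p r \<beta> (y / w) = (y / w)\<^sup>2 + 2 * q / ((\<beta> + 1) * r) * (y / w)
      + q * (q - 1) / (\<beta> * (\<beta> + 1) * r\<^sup>2)"
    by (simp add: quad_f_def)
  also have "\<beta> * (\<beta> + 1) * (r * w)\<^sup>2 * \<dots> =
      q * (q - 1) * w\<^sup>2 + 2 * q * \<beta> * r * y * w + \<beta> * (\<beta> + 1) * r\<^sup>2 * y\<^sup>2"
  proof -
    define c where "c = \<beta> + 1"
    have "c \<noteq> 0" using nz' by (simp add: c_def)
    then show ?thesis
      unfolding c_def[symmetric] using nz' w
      by (simp add: power2_eq_square divide_simps) (simp add: algebra_simps)
  qed
  finally show ?thesis by simp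
qed

text \<open>For positive \<open>t\<close> the quotient increases in \<open>y\<close>, so its value
  \<open>1 / (t - r)\<close> at \<open>y = 1\<close> is the worst case.\<close>

lemma quotient_le_if_mult_ge_1:
  fixes r t X y :: real
  assumes "0 < y" "y \<le> 1" "r < t" "0 < t" "r * y < t" "(t - r) * X \<ge> 1"
  shows "y / (t - r * y) \<le> X"
proof -
  have "y / (t - r * y) \<le> 1 / (t - r)"
    using assms by (simp add: field_simps)
  also have "\<dots> \<le> X"
    using assms by (simp add: field_simps)
  finally show ?thesis .
qed

section \<open>Reduction to the simplex and case distinction\<close>

theorem theorem3p2:
  fixes n :: nat and a :: "nat \<Rightarrow> real" and m p t r \<beta> s :: real
  assumes "n \<ge> 1"
    and "\<And>i. i \<in> {1..n} \<Longrightarrow> a i > 0"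
    and "t \<ge> 0"
    and "\<beta> * p * t \<noteq> 0"
    and "s = (\<Sum>i=1..n. a i powr p)"
    and "\<And>i. i \<in> {1..n} \<Longrightarrow> t * s > r * a i powr p"
    and "(\<beta> > 0 \<and>
            ((\<beta> \<ge> 1 \<and> r \<ge> 0 \<and> (\<beta> * p^2 \<le> p * m \<or> m = (\<beta> + 1) * p)) \<or>
             (\<beta> \<ge> 1 \<and> r < 0 \<and> (\<beta> + 1) * p^2 \<le> p * m) \<or>
             (\<beta> \<in> {0<..<1} \<and> r \<ge> 0 \<and> p^2 \<le> p * m \<and> p * m \<le> (\<beta> + 1) * p^2) \<or>
             (r < 0 \<and> max \<beta> 1 * p^2 \<le> p * m \<and> p * m < (\<beta> + 1) * p^2 \<and>
                (t - r) * root_X1 m p r \<beta> \<ge> 1)))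
       \<or> (\<beta> \<in> {-1<..<0} \<and>
            ((r = 0 \<and> \<beta> * p^2 < p * m \<and> p * m \<le> 0) \<or>
             (t \<ge> r \<and> p * m \<le> \<beta> * p^2) \<or>
             (t > r \<and> r \<noteq> 0 \<and> \<beta> * p^2 < p * m \<and> p * m \<le> 0 \<and>
                (t - r) * root_X2 m p r \<beta> \<ge> 1)))
       \<or> (\<beta> = -1 \<and>
            (p * m \<le> - (p^2) \<or> m = 0 \<or>
             (r \<ge> 0 \<and> - (p^2) < p * m \<and> p * m < 0) \<or>
             (r < 0 \<and> - (p^2) < p * m \<and> p * m < 0 \<and> ((m - p) * t) / ((m + p) * r) \<ge> 1)))
       \<or> (\<beta> < -1 \<and>
            (p * m \<le> \<beta> * p^2 \<or> m = (\<beta> + 1) * p \<or>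
             (r \<ge> 0 \<and> \<beta> * p^2 < p * m \<and> p * m < (\<beta> + 1) * p^2) \<or>
             (r < 0 \<and> \<beta> * p^2 < p * m \<and> p * m < (\<beta> + 1) * p^2 \<and>
                (t - r) * root_X1 m p r \<beta> \<ge> 1)))"
  shows "(\<Sum>i=1..n. a i powr m / (t * s - r * a i powr p) powr \<beta>)
           \<ge> 1 / (real n * t - r) powr \<beta> * (\<Sum>i=1..n. a i powr (m - \<beta> * p))"
proof -
  define q where "q = m / p"
  define y where "y i = a i powr p / s" for i
  have nz: "\<beta> \<noteq> 0" "p \<noteq> 0" and t: "t > 0"
    using assms(3,4) by auto
  have p2: "p\<^sup>2 > 0" using nz by simp
  have a: "a i > 0" if "i \<in> {1..n}" for i using assms(2) that .
  have s: "s > 0"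
    unfolding assms(5) using a assms(1) by (intro sum_pos) fastforce+
  interpret simplex_point "{1..n}" y t r
  proof
    show "(\<Sum>i=1..n. y i) = 1"
      using s assms(5) by (simp add: y_def flip: sum_divide_distrib)
    show "r * y i < t" if "i \<in> {1..n}" for i
      using assms(6)[OF that] s by (simp add: y_def field_simps)
    show "y i > 0" if "i \<in> {1..n}" for i
      using a[OF that] s by (simp add: y_def)
  qed (use t assms(1) in auto)
  \<comment> \<open>Dividing by the positive \<open>p\<^sup>2\<close> turns the conditions on
    \<open>p * m\<close> into conditions on \<open>q\<close>, whatever the sign of
    \<open>p\<close>.\<close>
  have pm: "p * m = q * p\<^sup>2" and m: "m = q * p"
    using nz by (simp_all add: q_def power2_eq_square)
  have le: "c * p\<^sup>2 \<le> q * p\<^sup>2 \<longleftrightarrow> c \<le> q" "q * p\<^sup>2 \<le> c * p\<^sup>2 \<longleftrightarrow> q \<le> c"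
    "c * p\<^sup>2 < q * p\<^sup>2 \<longleftrightarrow> c < q" "q * p\<^sup>2 < c * p\<^sup>2 \<longleftrightarrow> q < c" for c
    using p2 by auto
  have le': "p\<^sup>2 \<le> q * p\<^sup>2 \<longleftrightarrow> 1 \<le> q" "q * p\<^sup>2 \<le> 0 \<longleftrightarrow> q \<le> 0" "q * p\<^sup>2 < 0 \<longleftrightarrow> q < 0"
    "q * p\<^sup>2 \<le> - p\<^sup>2 \<longleftrightarrow> q \<le> -1" "- p\<^sup>2 < q * p\<^sup>2 \<longleftrightarrow> -1 < q"
    using le[of 1] le[of 0] le[of "-1"] by simp_all
  have mq: "m = 0 \<longleftrightarrow> q = 0" "m = (\<beta> + 1) * p \<longleftrightarrow> q = \<beta> + 1"
    using nz by (auto simp: m)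
  note cases = assms(7)[unfolded pm le le' mq]

  have "(\<Sum>i=1..n. y i powr q * (t - r * y i) powr (- \<beta>))
     \<ge> (real n * t - r) powr (- \<beta>) * (\<Sum>i=1..n. y i powr (q - \<beta>))"
  proof -
    have A: ?thesis if "\<beta> > 0 \<and> q \<ge> \<beta> + 1 \<or> \<beta> \<le> -1 \<and> q \<le> \<beta> + 1"
      using sum_ge_if_convex_in_inverse[OF that] by simp
    have C: ?thesis if "\<beta> \<le> q" "q \<le> \<beta> + 1"
      "\<And>y. 0 < y \<Longrightarrow> y \<le> 1 \<Longrightarrow> r * y < t \<Longrightarrow>
        0 \<le> q * (q - 1) * (t - r * y)\<^sup>2 + 2 * q * \<beta> * r * y * (t - r * y) + \<beta> * (\<beta> + 1) * r\<^sup>2 * y\<^sup>2"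
      using sum_ge_if_convex[OF that(3,1,2)] by simp
    \<comment> \<open>All cases with \<open>\<beta> \<le> -1\<close> have
      \<open>q \<le> \<beta> + 1\<close> and fall under \<open>inverse\<close>. For
      \<open>\<beta> \<ge> 1\<close>, \<open>r \<ge> 0\<close> and \<open>q \<ge> \<beta>\<close>,
      the value \<open>\<beta> + 1\<close> separates \<open>inverse\<close> from
      \<open>termwise\<close>.\<close>
    consider
        (inverse) "\<beta> > 0 \<and> q \<ge> \<beta> + 1 \<or> \<beta> \<le> -1 \<and> q \<le> \<beta> + 1"
      | (termwise) "\<beta> > 0" "r \<ge> 0" "1 \<le> q" "\<beta> \<le> q" "q \<le> \<beta> + 1"
      | (X1) "\<beta> > 0" "r < 0" "1 \<le> q" "\<beta> \<le> q" "q < \<beta> + 1" "(t - r) * root_X1 m p r \<beta> \<ge> 1"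
      | (r0) "-1 < \<beta>" "\<beta> < 0" "r = 0" "\<beta> < q" "q \<le> 0"
      | (ordered) "\<beta> < 0" "r \<le> t" "q \<le> \<beta>"
      | (X2) "-1 < \<beta>" "\<beta> < 0" "r < t" "r \<noteq> 0" "\<beta> < q" "q \<le> 0" "(t - r) * root_X2 m p r \<beta> \<ge> 1"
      using cases unfolding greaterThanLessThan_iff by (smt (verit) max_def)
    then show ?thesis
    proof cases
      case inverse
      then show ?thesis by (rule A)
    next
      case termwise
      \<comment> \<open>Each of the three terms of the convexity condition is nonnegative.\<close>
      then show ?thesis by (intro C) simp_all
    next
      case X1
      have nz': "\<beta> * (\<beta> + 1) * r * p \<noteq> 0" using X1 nz by simp
      show ?thesis
      proof (rule C)
        fix y assume y: "0 < y" "y \<le> 1" "r * y < t"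
        then have "y / (t - r * y) \<le> root_X1 m p r \<beta>"
          using X1 t by (intro quotient_le_if_mult_ge_1) auto
        then have "quad_f m p r \<beta> (y / (t - r * y)) \<ge> 0"
          by (rule quad_f_nonneg_if_le_root_X1[OF nz'])
        then show "0 \<le> q * (q - 1) * (t - r * y)\<^sup>2 + 2 * q * \<beta> * r * y * (t - r * y) + \<beta> * (\<beta> + 1) * r\<^sup>2 * y\<^sup>2"
          using X1 y by (subst second_derivative_factor_eq_quad_f[OF nz' _ q_def]) auto
      qed (use X1 in auto)
    next
      case r0
      \<comment> \<open>Only \<open>q * (q - 1) * t\<^sup>2\<close> survives, and
        \<open>q \<le> 0\<close>.\<close>
      then show ?thesis by (intro C) (auto simp: zero_le_mult_iff)
    next
      case ordered
      then show ?thesis using sum_ge_if_similarly_ordered[of \<beta> q] by simp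
    next
      case X2
      have nz': "\<beta> * (\<beta> + 1) * r * p \<noteq> 0" using X2 nz by simp
      have neg: "\<beta> * (\<beta> + 1) \<le> 0" using X2 by (simp add: mult_nonpos_nonneg)
      \<comment> \<open>With \<open>y = 0\<close> and \<open>w = 1\<close> the form reduces to
        \<open>q * (q - 1)\<close>, nonnegative as \<open>q \<le> 0\<close>; the negative factor in
        front then forces \<open>quad_f\<close> to be nonpositive at 0.\<close>
      have "0 \<le> \<beta> * (\<beta> + 1) * r\<^sup>2 * quad_f m p r \<beta> 0"
        using second_derivative_factor_eq_quad_f[OF nz' one_neq_zero q_def, of 0]
          mult_nonpos_nonpos[of q "q - 1"] X2 by simp
      moreover have "\<beta> * (\<beta> + 1) * r\<^sup>2 < 0"
        using X2 by (simp add: mult_neg_pos)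
      ultimately have 0: "quad_f m p r \<beta> 0 \<le> 0"
        by (metis mult_neg_pos not_le)
      show ?thesis
      proof (rule C)
        fix y assume y: "0 < y" "y \<le> 1" "r * y < t"
        then have "y / (t - r * y) \<le> root_X2 m p r \<beta>"
          using X2 t by (intro quotient_le_if_mult_ge_1) auto
        then have "quad_f m p r \<beta> (y / (t - r * y)) \<le> 0"
          using y by (intro quad_f_nonpos_if_le_root_X2[OF nz' _ _ 0]) auto
        then show "0 \<le> q * (q - 1) * (t - r * y)\<^sup>2 + 2 * q * \<beta> * r * y * (t - r * y) + \<beta> * (\<beta> + 1) * r\<^sup>2 * y\<^sup>2"
          using y neg
          by (subst second_derivative_factor_eq_quad_f[OF nz' _ q_def])
            (auto intro!: mult_nonpos_nonpos mult_nonpos_nonneg)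
      qed (use X2 in auto)
    qed
  qed
  \<comment> \<open>Undoing the normalisation: both sides have degree \<open>q - \<beta>\<close> in
    \<open>s\<close>.\<close>
  then have "s powr (q - \<beta>) * ((real n * t - r) powr (- \<beta>) * (\<Sum>i=1..n. y i powr (q - \<beta>)))
      \<le> s powr (q - \<beta>) * (\<Sum>i=1..n. y i powr q * (t - r * y i) powr (- \<beta>))"
    by (rule mult_left_mono) simp
  also have "\<dots> = (\<Sum>i=1..n. a i powr m / (t * s - r * a i powr p) powr \<beta>)"
    unfolding sum_distrib_left
  proof (rule sum.cong[OF refl])
    fix i assume i: "i \<in> {1..n}"
    have base: "t * s - r * a i powr p = s * (t - r * y i)"
      using s by (simp add: y_def field_simps)
    have num: "a i powr m = s powr q * y i powr q"
      using a[OF i] s by (simp add: y_def powr_divide powr_powr m mult.commute)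
    show "s powr (q - \<beta>) * (y i powr q * (t - r * y i) powr (- \<beta>))
        = a i powr m / (t * s - r * a i powr p) powr \<beta>"
      using dom[OF i] s unfolding base num
      by (simp add: powr_mult powr_diff powr_minus divide_inverse mult_ac)
  qed
  also have "s powr (q - \<beta>) * ((real n * t - r) powr (- \<beta>) * (\<Sum>i=1..n. y i powr (q - \<beta>)))
      = (real n * t - r) powr (- \<beta>) * (\<Sum>i=1..n. s powr (q - \<beta>) * y i powr (q - \<beta>))"
    by (simp add: sum_distrib_left mult_ac)
  also have "(\<Sum>i=1..n. s powr (q - \<beta>) * y i powr (q - \<beta>)) = (\<Sum>i=1..n. a i powr (m - \<beta> * p))"
    using a s by (intro sum.cong) (auto simp: y_def powr_divide powr_powr m algebra_simps)
  finally show ?thesis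
    by (simp add: powr_minus_divide)
qed

end
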